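(* Let $G$ be an infinite, connected, locally finite, simple graph which is quasi-transitive and $d$-regular. Then $p_c(G) \geq \frac{1}{d-1}$, and equality $p_c(G) = \frac{1}{d-1}$ holds if and only if $G$ is a tree.
   Context: All graphs are infinite, connected, locally finite and simple. A graph is $d$-regular if every vertex has exactly $d$ neighbours (for such infinite connected graphs, necessarily $d \geq 2$). Let $\mathrm{AUT}(G)$ be the group of all automorphisms of $G$ (adjacency-preserving bijections of the vertex set). $G$ is called quasi-transitive if the action of $\mathrm{AUT}(G)$ on the vertices of $G$ has finitely many orbits. Bernoulli bond percolation with parameter $p \in [0,1]$ on $G$: each edge is retained independently with probability $p$ and deleted with probability $1-p$; $\mathbb{P}_p$ denotes the corresponding probability measure. Let $\psi(p) = \mathbb{P}_p(\text{there exists an infinite connected component of retained edges})$. The critical parameter is $p_c(G) := \sup\{p \in [0,1] : \psi(p) = 0\}$. *)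

theory Defs
  imports "HOL-Probability.Probability" "HOL-Algebra.Group_Action"
begin

text \<open>A simple graph is given by a vertex set \<open>V\<close> and a set \<open>E\<close> of two-element subsets of \<open>V\<close>.\<close>

definition simple_graph :: "'a set \<Rightarrow> 'a set set \<Rightarrow> bool" where
  "simple_graph V E \<longleftrightarrow> (\<forall>e\<in>E. e \<subseteq> V \<and> card e = 2)"

definition adjacent :: "'a set set \<Rightarrow> 'a \<Rightarrow> 'a \<Rightarrow> bool" where
  "adjacent E u v \<longleftrightarrow> {u, v} \<in> E"

definition neighbours :: "'a set set \<Rightarrow> 'a \<Rightarrow> 'a set" where
  "neighbours E v = {u. adjacent E v u}"

definition locally_finite :: "'a set \<Rightarrow> 'a set set \<Rightarrow> bool" where
  "locally_finite V E \<longleftrightarrow> (\<forall>v\<in>V. finite (neighbours E v))"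

definition regular_graph :: "nat \<Rightarrow> 'a set \<Rightarrow> 'a set set \<Rightarrow> bool" where
  "regular_graph d V E \<longleftrightarrow> (\<forall>v\<in>V. finite (neighbours E v) \<and> card (neighbours E v) = d)"

definition component_of :: "'a set \<Rightarrow> 'a set set \<Rightarrow> 'a \<Rightarrow> 'a set" where
  "component_of V E v = {u \<in> V. (adjacent E)\<^sup>*\<^sup>* v u}"

definition graph_components :: "'a set \<Rightarrow> 'a set set \<Rightarrow> 'a set set" where
  "graph_components V E = component_of V E ` V"

definition connected_graph :: "'a set \<Rightarrow> 'a set set \<Rightarrow> bool" where
  "connected_graph V E \<longleftrightarrow> V \<noteq> {} \<and> (\<forall>u\<in>V. \<forall>v\<in>V. (adjacent E)\<^sup>*\<^sup>* u v)"

definition graph_cycle :: "'a set set \<Rightarrow> 'a list \<Rightarrow> bool" where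
  "graph_cycle E vs \<longleftrightarrow> 3 \<le> length vs \<and> distinct vs \<and>
     (\<forall>i. Suc i < length vs \<longrightarrow> adjacent E (vs ! i) (vs ! Suc i)) \<and>
     adjacent E (last vs) (hd vs)"

definition tree_graph :: "'a set \<Rightarrow> 'a set set \<Rightarrow> bool" where
  "tree_graph V E \<longleftrightarrow> connected_graph V E \<and> (\<nexists>vs. graph_cycle E vs)"

text \<open>As for \<open>AutoGroup\<close> in the library, automorphisms are extensional bijections, so that
  distinct elements of the group act differently on \<open>V\<close>.\<close>

definition graph_automorphisms :: "'a set \<Rightarrow> 'a set set \<Rightarrow> ('a \<Rightarrow> 'a) set" where
  "graph_automorphisms V E =
     {f \<in> Bij V. \<forall>u\<in>V. \<forall>v\<in>V. adjacent E (f u) (f v) \<longleftrightarrow> adjacent E u v}"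

definition AUT :: "'a set \<Rightarrow> 'a set set \<Rightarrow> ('a \<Rightarrow> 'a) monoid" where
  "AUT V E = BijGroup V \<lparr>carrier := graph_automorphisms V E\<rparr>"

lemma subgroup_graph_automorphisms: "subgroup (graph_automorphisms V E) (BijGroup V)"
proof (rule group.subgroupI[OF group_BijGroup])
  show "graph_automorphisms V E \<subseteq> carrier (BijGroup V)"
    by (auto simp: graph_automorphisms_def BijGroup_def)
  have "(\<lambda>x\<in>V. x) \<in> graph_automorphisms V E"
    by (simp add: graph_automorphisms_def id_Bij)
  then show "graph_automorphisms V E \<noteq> {}" by blast
next
  fix f assume f: "f \<in> graph_automorphisms V E"
  then have fB: "f \<in> Bij V" by (simp add: graph_automorphisms_def)
  define g where "g = (\<lambda>x\<in>V. inv_into V f x)"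
  have im: "f ` V = V" using fB by (simp add: Bij_def bij_betw_def)
  have g: "g x \<in> V" "f (g x) = x" if "x \<in> V" for x
    using that im by (auto simp: g_def inv_into_into f_inv_into_f)
  have "g \<in> Bij V" using fB by (simp add: g_def restrict_inv_into_Bij)
  moreover have "adjacent E (g u) (g v) \<longleftrightarrow> adjacent E u v" if "u \<in> V" "v \<in> V" for u v
  proof -
    have "adjacent E (f (g u)) (f (g v)) \<longleftrightarrow> adjacent E (g u) (g v)"
      using f g(1) that unfolding graph_automorphisms_def by blast
    then show ?thesis using g(2) that by simp
  qed
  ultimately show "inv\<^bsub>BijGroup V\<^esub> f \<in> graph_automorphisms V E"
    using fB by (simp only: inv_BijGroup graph_automorphisms_def g_def[symmetric]) simp
next
  fix f g assume fg: "f \<in> graph_automorphisms V E" "g \<in> graph_automorphisms V E"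
  then have B: "f \<in> Bij V" "g \<in> Bij V" by (simp_all add: graph_automorphisms_def)
  have gV: "g x \<in> V" if "x \<in> V" for x
    using Bij_imp_funcset[OF B(2)] that by (rule funcset_mem)
  have "adjacent E (compose V f g u) (compose V f g v) \<longleftrightarrow> adjacent E u v"
    if "u \<in> V" "v \<in> V" for u v
  proof -
    have "adjacent E (f (g u)) (f (g v)) \<longleftrightarrow> adjacent E (g u) (g v)"
      using fg(1) gV that unfolding graph_automorphisms_def by blast
    also have "\<dots> \<longleftrightarrow> adjacent E u v"
      using fg(2) that unfolding graph_automorphisms_def by blast
    finally show ?thesis using that by (simp add: compose_eq)
  qed
  moreover have "f \<otimes>\<^bsub>BijGroup V\<^esub> g = compose V f g"
    using B by (simp add: BijGroup_def)
  ultimately show "f \<otimes>\<^bsub>BijGroup V\<^esub> g \<in> graph_automorphisms V E"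
    using compose_Bij[OF B] by (simp only: graph_automorphisms_def) simp
qed

lemma group_action_AUT: "group_action (AUT V E) V (\<lambda>f. f)"
  using group.canonical_inj_is_hom[OF group_BijGroup subgroup_graph_automorphisms]
  by (simp add: group_action_def AUT_def id_def)

definition quasi_transitive :: "'a set \<Rightarrow> 'a set set \<Rightarrow> bool" where
  "quasi_transitive V E \<longleftrightarrow> finite (orbits (AUT V E) V (\<lambda>f. f))"

text \<open>Outside \<open>{0..1}\<close> the library clamps the parameter of \<open>bernoulli_pmf\<close>; only
  \<open>p \<in> {0..1}\<close> is used below.\<close>

definition percolation :: "'a set set \<Rightarrow> real \<Rightarrow> ('a set \<Rightarrow> bool) measure" where
  "percolation E p = PiM E (\<lambda>_. measure_pmf (bernoulli_pmf p))"

definition retained :: "'a set set \<Rightarrow> ('a set \<Rightarrow> bool) \<Rightarrow> 'a set set" where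
  "retained E \<omega> = {e \<in> E. \<omega> e}"

text \<open>The event below is measurable for connected locally finite graphs: their edge sets are
  countable.\<close>

definition percolation_prob :: "'a set \<Rightarrow> 'a set set \<Rightarrow> real \<Rightarrow> real" where
  "percolation_prob V E p = measure (percolation E p)
     {\<omega> \<in> space (percolation E p). \<exists>C \<in> graph_components V (retained E \<omega>). infinite C}"

definition p_c :: "'a set \<Rightarrow> 'a set set \<Rightarrow> real" where
  "p_c V E = Sup {p \<in> {0..1}. percolation_prob V E p = 0}"

end

theory Submission
  imports Defs
begin

text \<open>The lower bound is a first moment argument. In an infinite component there are retained
  self-avoiding walks of every length from each of its vertices (\<open>infinite_component_iff_saw\<close>). If
  every directed edge has at most \<open>B\<close> self-avoiding continuations by \<open>L\<close> edges, then cutting walks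
  into blocks shows that the expected number of retained walks with \<open>1 + k L\<close> edges is at most
  \<open>d p (B p ^ L) ^ k\<close>, so there is no percolation when \<open>B p ^ L < 1\<close> (\<open>percolation_prob_eq_0\<close>).
  Every edge has \<open>(d - 1) ^ L\<close> nonbacktracking continuations, and \<open>L = 1\<close> gives the bound
  \<open>1 / (d - 1)\<close>.

  If the graph has a cycle, finitely many orbits of automorphisms make a cycle of some fixed length
  available within a fixed distance of every vertex. From every directed edge one can then walk to
  such a cycle and around it without turning back, in a number of steps that is bounded uniformly
  (\<open>reach_cycle_nonbacktracking\<close>). So for one fixed \<open>L\<close> some nonbacktracking continuation always
  fails to be self-avoiding, \<open>B\<close> can be taken as \<open>(d - 1) ^ L - 1\<close>, and the inequality becomes
  strict.

  If the graph is a tree and \<open>(d - 1) p > 1\<close>, a second moment argument shows that retained walks of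
  length \<open>n\<close> exist with probability bounded below uniformly in \<open>n\<close>. On a tree two walks that separate
  never share an edge again, which yields a recursion for the second moment (\<open>tree_pair_sum_le\<close>)
  whose solution is at most a constant times the square of the first moment.\<close>

section \<open>Nonbacktracking walks\<close>

fun nonbacktracking :: "'a set set \<Rightarrow> 'a list \<Rightarrow> bool" where
  "nonbacktracking E (x # y # z # zs) \<longleftrightarrow>
     adjacent E x y \<and> x \<noteq> z \<and> nonbacktracking E (y # z # zs)"
| "nonbacktracking E [x, y] \<longleftrightarrow> adjacent E x y"
| "nonbacktracking E [x] \<longleftrightarrow> True"
| "nonbacktracking E [] \<longleftrightarrow> True"

lemma adjacent_sym: "adjacent E u v \<longleftrightarrow> adjacent E v u"
  by (simp add: adjacent_def insert_commute)

lemma append_last_two: "\<exists>zs a. x # y # ys = zs @ [a, last (y # ys)]"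
proof (induction ys arbitrary: x y)
  case Nil
  show ?case by (rule exI[of _ "[]"]) simp
next
  case (Cons z ys)
  then obtain zs a where "y # z # ys = zs @ [a, last (z # ys)]" by blast
  then have "x # y # z # ys = (x # zs) @ [a, last (y # z # ys)]" by simp
  then show ?case by blast
qed

text \<open>Whether a walk turns back is seen on three consecutive vertices, so walks that overlap in two
  vertices can be glued.\<close>

lemma nonbacktracking_glue:
  "nonbacktracking E (xs @ a # b # ys) \<longleftrightarrow>
     nonbacktracking E (xs @ [a, b]) \<and> nonbacktracking E (a # b # ys)"
proof (induction xs)
  case Nil
  then show ?case by (cases ys) auto
next
  case (Cons x xs)
  then show ?case
    by (cases xs; cases "tl xs") auto
qed

lemma nonbacktracking_snoc2:
  "nonbacktracking E (xs @ [a, b, c]) \<longleftrightarrow>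
     nonbacktracking E (xs @ [a, b]) \<and> adjacent E b c \<and> a \<noteq> c"
  using nonbacktracking_glue[of E xs a b "[c]"] nonbacktracking_glue[of E xs a b "[]"]
  by (cases xs) auto

lemma nonbacktracking_rev: "nonbacktracking E (rev xs) \<longleftrightarrow> nonbacktracking E xs"
proof (induction xs rule: nonbacktracking.induct)
  case (1 E x y z zs)
  have "nonbacktracking E (rev (x # y # z # zs)) \<longleftrightarrow> nonbacktracking E (rev zs @ z # y # [x])"
    by simp
  also have "\<dots> \<longleftrightarrow> nonbacktracking E (rev (y # z # zs)) \<and> nonbacktracking E [z, y, x]"
    by (subst nonbacktracking_glue) simp
  finally have "nonbacktracking E (rev (x # y # z # zs)) \<longleftrightarrow>
    nonbacktracking E (y # z # zs) \<and> nonbacktracking E [z, y, x]"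
    using 1 by simp
  moreover have "nonbacktracking E (y # z # zs) \<Longrightarrow> adjacent E y z" by (cases zs) auto
  ultimately show ?case
    by (auto simp: adjacent_sym[of E z y] adjacent_sym[of E y x])
qed (auto simp: adjacent_sym)

lemma nonbacktracking_appendD:
  assumes "nonbacktracking E (xs @ ys)"
  shows "nonbacktracking E xs" "nonbacktracking E ys"
proof -
  have *: "nonbacktracking E ys" if "nonbacktracking E (xs @ ys)" for xs ys
    using that
  proof (induction xs)
    case (Cons x xs)
    then show ?case by (cases "xs @ ys" ; cases "tl (xs @ ys)") auto
  qed simp
  show "nonbacktracking E ys" by (rule *[OF assms])
  have "nonbacktracking E (rev ys @ rev xs)"
    using assms by (metis nonbacktracking_rev rev_append)
  then show "nonbacktracking E xs" using * nonbacktracking_rev by blast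
qed

lemma nonbacktracking_imp_walk: "nonbacktracking E xs \<Longrightarrow> successively (adjacent E) xs"
  by (induction xs rule: nonbacktracking.induct) auto

lemma distinct_walk_nonbacktracking:
  "successively (adjacent E) xs \<Longrightarrow> distinct xs \<Longrightarrow> nonbacktracking E xs"
  by (induction xs rule: nonbacktracking.induct) auto

text \<open>Only the vertices after the edge from \<open>u\<close> to \<open>v\<close> are recorded, so that a longer
  walk is the walk up to \<open>v\<close> followed by a continuation.\<close>

definition continuations :: "'a set set \<Rightarrow> nat \<Rightarrow> 'a \<Rightarrow> 'a \<Rightarrow> 'a list set" where
  "continuations E n u v = {ys. length ys = n \<and> nonbacktracking E (u # v # ys)}"

lemma continuations_0: "adjacent E u v \<Longrightarrow> continuations E 0 u v = {[]}"
  by (auto simp: continuations_def)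

lemma continuations_Suc:
  assumes "adjacent E u v"
  shows "continuations E (Suc n) u v =
    (\<Union>w\<in>neighbours E v - {u}. (#) w ` continuations E n v w)" (is "?L = ?R")
proof
  show "?L \<subseteq> ?R"
  proof
    fix ys assume "ys \<in> ?L"
    then obtain w zs where "ys = w # zs" "length zs = n" "nonbacktracking E (u # v # w # zs)"
      by (auto simp: continuations_def length_Suc_conv)
    moreover from this have "adjacent E v w" by (cases zs) auto
    ultimately show "ys \<in> ?R"
      by (auto simp: continuations_def neighbours_def)
  qed
  show "?R \<subseteq> ?L"
    using assms by (auto simp: continuations_def neighbours_def)
qed

lemma graph_cycle_nonbacktracking:
  assumes "graph_cycle E (c # cs)"
  shows "nonbacktracking E (c # cs @ [c])" "hd cs \<noteq> last cs" "cs \<noteq> []"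
proof -
  have len: "2 \<le> length cs" and dist: "distinct (c # cs)"
    and walk: "successively (adjacent E) (c # cs)" and close: "adjacent E (last (c # cs)) c"
    using assms by (auto simp: graph_cycle_def successively_conv_nth)
  obtain a as where cs1: "cs = a # as" using len by (cases cs) auto
  obtain bs b where cs2: "cs = bs @ [b]" using len by (cases cs rule: rev_cases) auto
  have ab: "as \<noteq> []" "bs \<noteq> []" using len cs1 cs2 by auto
  show "cs \<noteq> []" using cs1 by simp
  show "hd cs \<noteq> last cs" using cs1 ab dist by auto
  have nb: "nonbacktracking E (c # cs)"
    by (rule distinct_walk_nonbacktracking[OF walk dist])
  obtain bs' b' where bs: "bs = bs' @ [b']" using ab by (cases bs rule: rev_cases) auto
  have "nonbacktracking E ((c # bs') @ [b', b, c])"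
    unfolding nonbacktracking_snoc2 using nb close dist by (auto simp: cs2 bs)
  then show "nonbacktracking E (c # cs @ [c])" by (simp add: cs2 bs)
qed

text \<open>The last vertex that is visited again later and its next visit bound a segment without inner
  repetition. It is a cycle, with at least three vertices since the graph has no loops and the walk
  never turns back.\<close>

lemma nonbacktracking_distinct_or_cycle:
  assumes "simple_graph V E" "nonbacktracking E xs" "\<not> distinct xs"
  shows "\<exists>cs. graph_cycle E cs"
  using assms(2,3)
proof (induction xs)
  case (Cons x xs)
  show ?case
  proof (cases "distinct xs")
    case False
    then show ?thesis
      using Cons nonbacktracking_appendD(2)[of E "[x]" xs] by simp
  next
    case True
    then have "x \<in> set xs" using Cons.prems by simp
    then obtain ys zs where xs: "xs = ys @ x # zs" and ys: "x \<notin> set ys"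
      by (metis split_list_first)
    have nb: "nonbacktracking E (x # ys @ [x])"
      using nonbacktracking_appendD(1)[of E "x # ys @ [x]" zs] Cons.prems xs by simp
    have loop: "\<not> adjacent E x x"
      using assms(1) by (auto simp: simple_graph_def adjacent_def)
    have "ys \<noteq> []" using nb loop by auto
    moreover have "tl ys \<noteq> []" using nb \<open>ys \<noteq> []\<close> by (cases ys) auto
    ultimately have len: "3 \<le> length (x # ys)" by (cases ys; cases "tl ys") auto
    have walk: "successively (adjacent E) ((x # ys) @ [x])"
      using nonbacktracking_imp_walk[OF nb] by simp
    then have "successively (adjacent E) (x # ys)" "adjacent E (last (x # ys)) x"
      unfolding successively_append_iff by auto
    then have "graph_cycle E (x # ys)"
      unfolding graph_cycle_def using len True ys xs
      by (auto simp: successively_conv_nth)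
    then show ?thesis by blast
  qed
qed simp

text \<open>Suppose that a nonbacktracking walk ends at distance \<open>r\<close> from a cycle and is longer than
  \<open>r\<close>. Then its initial edge starts a nonbacktracking walk around the cycle. The way to the cycle
  may go back along the walk, and the induction removes the edges on which it does; since the walk is longer
  than \<open>r\<close>, its first edge survives. On arrival, one of the two directions around the cycle does
  not turn back.\<close>

lemma reach_cycle_nonbacktracking:
  assumes "nonbacktracking E (x0 # x1 # xs)"
    and "successively (adjacent E) (g @ [c])"
    and "hd (g @ [c]) = last (x1 # xs)" "length g \<le> length xs"
    and "nonbacktracking E (c # cs @ [c])" "hd cs \<noteq> last cs" "cs \<noteq> []"
  shows "\<exists>ys. nonbacktracking E (x0 # x1 # ys) \<and> \<not> distinct (x0 # x1 # ys) \<and>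
           length ys \<le> length xs + length g + length cs + 1"
  using assms(1-4)
proof (induction g arbitrary: xs)
  case Nil
  obtain zs a where za: "x0 # x1 # xs = zs @ [a, c]"
    using append_last_two[of x0 x1 xs] Nil by auto
  have go: "?case" if cyc: "nonbacktracking E (c # ds @ [c])" "hd ds \<noteq> a" "ds \<noteq> []"
    "length ds = length cs" for ds
  proof -
    obtain b bs where b: "ds = b # bs" using cyc by (cases ds) auto
    have "nonbacktracking E (a # c # ds @ [c])"
      using cyc b Nil.prems(1) za nonbacktracking_appendD(2)[of E zs "[a, c]"]
      by (cases bs) auto
    then have "nonbacktracking E (zs @ a # c # ds @ [c])"
      using Nil.prems(1) za nonbacktracking_glue by metis
    moreover have "zs @ a # c # ds @ [c] = (zs @ [a, c]) @ ds @ [c]" by simp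
    ultimately have "nonbacktracking E (x0 # x1 # xs @ ds @ [c])"
      unfolding za[symmetric] by simp
    moreover have "\<not> distinct (x0 # x1 # xs @ ds @ [c])"
    proof -
      have "c \<in> set (x1 # xs)" using Nil.prems(3) last_in_set[of "x1 # xs"] by simp
      then show ?thesis by auto
    qed
    ultimately show ?thesis
      using cyc(4) by (intro exI[of _ "xs @ ds @ [c]"]) simp
  qed
  show ?case
  proof (cases "hd cs = a")
    case False
    then show ?thesis using go[of cs] assms(5-7) by simp
  next
    case True
    have "nonbacktracking E (rev (c # cs @ [c]))" using assms(5) by (simp only: nonbacktracking_rev)
    then have "nonbacktracking E (c # rev cs @ [c])" by simp
    moreover have "hd (rev cs) \<noteq> a" using True assms(6,7) by (simp add: hd_rev)
    ultimately show ?thesis using go[of "rev cs"] assms(7) by simp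
  qed
next
  case (Cons m g)
  have "xs \<noteq> []" using Cons.prems(4) by auto
  then obtain ws where ws: "xs = ws @ [m]"
    using Cons.prems(3) by (cases xs rule: rev_cases) auto
  define h where "h = hd (g @ [c])"
  have mh: "adjacent E m h" and walk: "successively (adjacent E) (g @ [c])"
    using Cons.prems(2) by (auto simp: successively_Cons h_def)
  show ?case
  proof (cases "h = last (x1 # ws)")
    case True
    have "nonbacktracking E (x0 # x1 # ws)"
      using Cons.prems(1) nonbacktracking_appendD(1)[of E "x0 # x1 # ws" "[m]"] ws by simp
    from Cons.IH[OF this walk] True Cons.prems(4) ws
    obtain ys where "nonbacktracking E (x0 # x1 # ys)" "\<not> distinct (x0 # x1 # ys)"
      "length ys \<le> length ws + length g + length cs + 1"
      by (auto simp: h_def)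
    then show ?thesis using ws by (intro exI[of _ ys]) auto
  next
    case False
    obtain us a where ua: "x1 # ws = us @ [a]" by (cases "x1 # ws" rule: rev_cases) auto
    have "nonbacktracking E ((x0 # us) @ [a, m])"
      using Cons.prems(1) ws ua by (metis append_Cons append_Nil append_assoc)
    then have "nonbacktracking E ((x0 # us) @ [a, m, h])"
      unfolding nonbacktracking_snoc2 using mh False ua by simp
    moreover have "(x0 # us) @ [a, m, h] = x0 # x1 # xs @ [h]"
      using ws ua by (metis append_Cons append_Nil append_assoc)
    ultimately have "nonbacktracking E (x0 # x1 # xs @ [h])" by (simp only:)
    from Cons.IH[OF this walk] Cons.prems(4)
    obtain ys where "nonbacktracking E (x0 # x1 # ys)" "\<not> distinct (x0 # x1 # ys)"
      "length ys \<le> length (xs @ [h]) + length g + length cs + 1"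
      by (auto simp: h_def)
    then show ?thesis by (intro exI[of _ ys]) auto
  qed
qed

section \<open>Self-avoiding walks\<close>

definition saw :: "'a set set \<Rightarrow> 'a \<Rightarrow> nat \<Rightarrow> 'a list set" where
  "saw E x n = {xs. length xs = Suc n \<and> hd xs = x \<and> distinct xs \<and> successively (adjacent E) xs}"

lemma saw_prefix:
  assumes "xs \<in> saw E x (n + k)"
  shows "take (Suc n) xs \<in> saw E x n"
proof -
  have "successively (adjacent E) (take (Suc n) xs @ drop (Suc n) xs)"
    using assms by (simp add: saw_def)
  then have "successively (adjacent E) (take (Suc n) xs)"
    unfolding successively_append_iff by blast
  then show ?thesis using assms by (auto simp: saw_def hd_take)
qed

lemma finite_saw:
  assumes simple: "simple_graph V H" and fin: "\<And>u. u \<in> V \<Longrightarrow> finite (neighbours H u)" and "v \<in> V"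
  shows "finite (saw H v n)" and "xs \<in> saw H v n \<Longrightarrow> set xs \<subseteq> V"
proof -
  have V: "u \<in> V" "w \<in> V" if "adjacent H u w" for u w
    using simple that by (auto simp: simple_graph_def adjacent_def)
  have "finite (saw H v n) \<and> (\<forall>xs\<in>saw H v n. set xs \<subseteq> V)"
  proof (induction n)
    case 0
    have "saw H v 0 \<subseteq> {[v]}" by (auto simp: saw_def length_Suc_conv)
    then show ?case using \<open>v \<in> V\<close> finite_subset by fastforce
  next
    case (Suc n)
    have *: "\<exists>ys w. xs = ys @ [w] \<and> ys \<in> saw H v n \<and> w \<in> neighbours H (last ys)"
      if saw: "xs \<in> saw H v (Suc n)" for xs
    proof -
      obtain ys w where xs: "xs = ys @ [w]" "length ys = Suc n"
        using saw by (cases xs rule: rev_cases) (auto simp: saw_def)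
      then have ne: "ys \<noteq> []" by auto
      show ?thesis
        using saw xs ne
        by (intro exI[of _ ys] exI[of _ w]) (auto simp: saw_def successively_append_iff neighbours_def)
    qed
    have "saw H v (Suc n) \<subseteq> (\<Union>ys\<in>saw H v n. (\<lambda>w. ys @ [w]) ` neighbours H (last ys))"
      using * by blast
    moreover have "finite (\<Union>ys\<in>saw H v n. (\<lambda>w. ys @ [w]) ` neighbours H (last ys))"
    proof (intro finite_UN_I finite_imageI fin)
      fix ys assume "ys \<in> saw H v n"
      moreover from this have "ys \<noteq> []" by (auto simp: saw_def)
      ultimately show "last ys \<in> V" using Suc last_in_set[of ys] by blast
    qed (use Suc in auto)
    ultimately have "finite (saw H v (Suc n))" by (rule finite_subset)
    moreover have "set xs \<subseteq> V" if "xs \<in> saw H v (Suc n)" for xs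
      using *[OF that] Suc V(2) by (fastforce simp: neighbours_def)
    ultimately show ?case by blast
  qed
  then show "finite (saw H v n)" "xs \<in> saw H v n \<Longrightarrow> set xs \<subseteq> V" by auto
qed

lemma reachable_by_saw:
  assumes "(adjacent H)\<^sup>*\<^sup>* v u"
  shows "\<exists>n. \<exists>xs\<in>saw H v n. last xs = u"
  using assms
proof (induction rule: rtranclp_induct)
  case base
  have "[v] \<in> saw H v 0" by (simp add: saw_def)
  then show ?case by force
next
  case (step u w)
  then obtain n xs where xs: "xs \<in> saw H v n" "last xs = u" by blast
  show ?case
  proof (cases "w \<in> set xs")
    case True
    then obtain i where i: "i < length xs" "xs ! i = w" by (auto simp: in_set_conv_nth)
    then have "take (Suc i) xs \<in> saw H v i"
      using xs saw_prefix[of xs H v i "n - i"] by (auto simp: saw_def)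
    moreover have "last (take (Suc i) xs) = w" using i by (simp add: take_Suc_conv_app_nth)
    ultimately show ?thesis by blast
  next
    case False
    have ne: "xs \<noteq> []" using xs by (auto simp: saw_def)
    then have "xs @ [w] \<in> saw H v (Suc n)"
      using xs False step(2) by (auto simp: saw_def successively_append_iff)
    then show ?thesis by force
  qed
qed

lemma mem_walk_reachable:
  assumes "successively (adjacent H) (v # xs)" "u \<in> set (v # xs)"
  shows "(adjacent H)\<^sup>*\<^sup>* v u"
  using assms
proof (induction xs arbitrary: v)
  case (Cons w xs)
  show ?case
  proof (cases "u = v")
    case False
    then have "(adjacent H)\<^sup>*\<^sup>* w u" using Cons by auto
    then show ?thesis using Cons.prems(1) by (auto intro: converse_rtranclp_into_rtranclp)
  qed simp
qed simp

text \<open>If all self-avoiding walks from \<open>v\<close> had fewer than \<open>n\<close> edges, only finitely many vertices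
  could be reached. Conversely, a walk with \<open>n\<close> edges visits \<open>n + 1\<close> vertices of the component.\<close>

lemma infinite_component_iff_saw:
  assumes simple: "simple_graph V H" and fin: "\<And>u. u \<in> V \<Longrightarrow> finite (neighbours H u)" and v: "v \<in> V"
  shows "infinite (component_of V H v) \<longleftrightarrow> (\<forall>n. saw H v n \<noteq> {})"
proof
  assume inf: "infinite (component_of V H v)"
  show "\<forall>n. saw H v n \<noteq> {}"
  proof (rule ccontr)
    assume "\<not> ?thesis"
    then obtain n where n: "saw H v n = {}" by blast
    have "component_of V H v \<subseteq> (\<Union>k<n. last ` saw H v k)"
    proof
      fix u assume "u \<in> component_of V H v"
      then obtain k xs where xs: "xs \<in> saw H v k" "last xs = u"
        using reachable_by_saw[of H v u] by (auto simp: component_of_def)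
      have "k < n"
      proof (rule ccontr)
        assume "\<not> k < n"
        then have "take (Suc n) xs \<in> saw H v n" using saw_prefix[of xs H v n "k - n"] xs by simp
        then show False using n by simp
      qed
      then show "u \<in> (\<Union>k<n. last ` saw H v k)" using xs by blast
    qed
    moreover have "finite (\<Union>k<n. last ` saw H v k)"
      using finite_saw(1)[OF simple fin v] by blast
    ultimately show False using inf finite_subset by blast
  qed
next
  assume saw: "\<forall>n. saw H v n \<noteq> {}"
  show "infinite (component_of V H v)"
  proof
    assume fin': "finite (component_of V H v)"
    obtain xs where xs: "xs \<in> saw H v (card (component_of V H v))" using saw by blast
    then obtain ys where ys: "xs = v # ys" by (cases xs) (auto simp: saw_def)
    have "set xs \<subseteq> component_of V H v"
      using finite_saw(2)[OF simple fin v xs] mem_walk_reachable[of H v ys] xs ys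
      by (auto simp: component_of_def saw_def)
    then have "card (set xs) \<le> card (component_of V H v)" using fin' card_mono by blast
    then show False using xs by (simp add: saw_def distinct_card)
  qed
qed

locale regular_connected_graph =
  fixes V :: "'a set" and E :: "'a set set" and d :: nat
  assumes simple: "simple_graph V E"
    and infinite_V: "infinite V"
    and connected: "connected_graph V E"
    and regular: "regular_graph d V E"
begin

lemma adjacent_in_V:
  assumes "adjacent E u v"
  shows "u \<in> V" "v \<in> V"
  using simple assms by (auto simp: simple_graph_def adjacent_def)

lemma finite_neighbours: "v \<in> V \<Longrightarrow> finite (neighbours E v)"
  using regular by (simp add: regular_graph_def)

lemma saw_nonempty:
  assumes "v \<in> V"
  shows "saw E v n \<noteq> {}"
proof -
  have "component_of V E v = V"
    using connected assms by (auto simp: connected_graph_def component_of_def)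
  then show ?thesis
    using infinite_component_iff_saw[OF simple finite_neighbours assms] infinite_V by simp
qed

text \<open>Measurability of the percolation event rests on this.\<close>

lemma countable_V: "countable V"
proof -
  obtain v where v: "v \<in> V" using connected by (auto simp: connected_graph_def)
  have "V \<subseteq> (\<Union>n. last ` saw E v n)"
    using connected v reachable_by_saw[of E v] by (fastforce simp: connected_graph_def)
  moreover have "countable (\<Union>n. last ` saw E v n)"
    using finite_saw(1)[OF simple finite_neighbours v] by (intro countable_UN) (auto intro: countable_finite)
  ultimately show ?thesis by (rule countable_subset)
qed

lemma finite_continuations: "adjacent E u v \<Longrightarrow> finite (continuations E n u v)"
proof (induction n arbitrary: u v)
  case (Suc n)
  then show ?case
    using adjacent_in_V finite_neighbours
    by (auto simp: continuations_Suc neighbours_def intro!: finite_UN_I)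
qed (simp add: continuations_0)

text \<open>Sums over continuations are computed by recursion on the first step; with the constant
  \<open>1\<close> this counts them, and with probabilities it gives the moments used on trees.\<close>

lemma sum_continuations_Suc:
  assumes "adjacent E u v"
  shows "(\<Sum>ys\<in>continuations E (Suc n) u v. f ys) =
    (\<Sum>w\<in>neighbours E v - {u}. \<Sum>ys\<in>continuations E n v w. f (w # ys))"
proof -
  have "(\<Sum>ys\<in>continuations E (Suc n) u v. f ys) =
    (\<Sum>w\<in>neighbours E v - {u}. \<Sum>ys\<in>(#) w ` continuations E n v w. f ys)"
    unfolding continuations_Suc[OF assms]
    using assms adjacent_in_V finite_neighbours finite_continuations
    by (intro sum.UNION_disjoint) (auto simp: neighbours_def)
  then show ?thesis by (simp add: sum.reindex)
qed

lemma card_neighbours_Diff: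
  assumes "adjacent E u v"
  shows "card (neighbours E v - {u}) = d - 1"
  using regular assms adjacent_in_V[OF assms] adjacent_sym[of E u v]
  by (simp add: regular_graph_def neighbours_def)

lemma card_continuations:
  "adjacent E u v \<Longrightarrow> card (continuations E n u v) = (d - 1) ^ n"
proof (induction n arbitrary: u v)
  case (Suc n)
  have "card (continuations E (Suc n) u v) = (\<Sum>ys\<in>continuations E (Suc n) u v. 1)" by simp
  also have "\<dots> = (\<Sum>w\<in>neighbours E v - {u}. card (continuations E n v w))"
    by (simp only: sum_continuations_Suc[OF Suc.prems]) simp
  also have "\<dots> = (d - 1) ^ Suc n"
    using Suc by (simp add: neighbours_def card_neighbours_Diff[unfolded neighbours_def])
  finally show ?case .
qed (simp add: continuations_0)

text \<open>Cutting a walk after its first part embeds the longer walks into pairs of a shorter walk and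
  a continuation of its last edge.\<close>

lemma card_saw_extend:
  assumes bound: "\<And>u v. adjacent E u v \<Longrightarrow>
      card {ys \<in> continuations E L u v. distinct (u # v # ys)} \<le> B"
    and x: "x \<in> V"
  shows "card (saw E x (Suc n + L)) \<le> card (saw E x (Suc n)) * B"
proof -
  define ext where "ext u v = {ys \<in> continuations E L u v. distinct (u # v # ys)}" for u v
  define X where "X = (SIGMA xs:saw E x (Suc n). ext (xs ! n) (xs ! Suc n))"
  have adj: "adjacent E (xs ! n) (xs ! Suc n)" if "xs \<in> saw E x (Suc n)" for xs
    using that by (auto simp: saw_def intro: successively_nth)
  have fin: "finite (saw E x (Suc n))" by (rule finite_saw(1)[OF simple finite_neighbours x])
  have fin': "finite (ext (xs ! n) (xs ! Suc n))" if "xs \<in> saw E x (Suc n)" for xs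
    using finite_continuations[OF adj[OF that]] by (simp add: ext_def)
  let ?cut = "\<lambda>xs. (take (Suc (Suc n)) xs, drop (Suc (Suc n)) xs)"
  have "inj_on ?cut (saw E x (Suc n + L))"
    by (rule inj_onI) (metis append_take_drop_id prod.inject)
  moreover have "?cut ` saw E x (Suc n + L) \<subseteq> X"
  proof
    fix z assume "z \<in> ?cut ` saw E x (Suc n + L)"
    then obtain xs where xs: "xs \<in> saw E x (Suc n + L)" and z: "z = ?cut xs" by blast
    have len: "length xs = Suc (Suc n) + L" using xs by (simp add: saw_def)
    have "drop n xs = xs ! n # xs ! Suc n # drop (Suc (Suc n)) xs"
      using len by (simp add: Cons_nth_drop_Suc)
    moreover have "nonbacktracking E (drop n xs)"
      using xs distinct_walk_nonbacktracking[of E xs]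
        nonbacktracking_appendD(2)[of E "take n xs" "drop n xs"] by (simp add: saw_def)
    moreover have "distinct (drop n xs)" using xs by (simp add: saw_def)
    ultimately have "drop (Suc (Suc n)) xs \<in> ext (xs ! n) (xs ! Suc n)"
      using len by (simp add: ext_def continuations_def)
    then show "z \<in> X" using saw_prefix[OF xs] by (simp add: X_def z)
  qed
  moreover have "finite X" using fin fin' by (auto simp: X_def)
  ultimately have "card (saw E x (Suc n + L)) \<le> card X" by (meson card_inj_on_le)
  also have "card X = (\<Sum>xs\<in>saw E x (Suc n). card (ext (xs ! n) (xs ! Suc n)))"
    unfolding X_def using fin fin' by (simp add: card_SigmaI)
  also have "\<dots> \<le> (\<Sum>xs\<in>saw E x (Suc n). B)"
    unfolding ext_def by (intro sum_mono bound adj)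
  finally show ?thesis by simp
qed

lemma card_saw_le:
  assumes bound: "\<And>u v. adjacent E u v \<Longrightarrow>
      card {ys \<in> continuations E L u v. distinct (u # v # ys)} \<le> B"
    and x: "x \<in> V"
  shows "card (saw E x (Suc (k * L))) \<le> d * B ^ k"
proof (induction k)
  case 0
  have "saw E x 1 \<subseteq> (\<lambda>y. [x, y]) ` neighbours E x"
    by (auto simp: saw_def length_Suc_conv neighbours_def)
  then have "card (saw E x 1) \<le> card (neighbours E x)"
    using finite_neighbours[OF x] by (meson card_image_le card_mono finite_imageI le_trans)
  then show ?case using regular x by (simp add: regular_graph_def)
next
  case (Suc k)
  have "card (saw E x (Suc (Suc k * L))) \<le> card (saw E x (Suc (k * L))) * B"
    using card_saw_extend[OF bound x, where n = "k * L"] by (simp add: add.commute)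
  also have "\<dots> \<le> d * B ^ k * B" using Suc by simp
  finally show ?case by (simp add: mult.commute mult.left_commute)
qed

text \<open>The graph has arbitrarily long self-avoiding walks, so a bound on their continuations cannot
  be zero.\<close>

lemma continuation_bound_pos:
  assumes bound: "\<And>u v. adjacent E u v \<Longrightarrow>
      card {ys \<in> continuations E L u v. distinct (u # v # ys)} \<le> B"
  shows "0 < B"
proof (rule ccontr)
  assume "\<not> 0 < B"
  obtain x where x: "x \<in> V" using connected by (auto simp: connected_graph_def)
  have "card (saw E x (Suc (1 * L))) \<le> d * B ^ 1" by (rule card_saw_le[OF bound x])
  then have "card (saw E x (Suc L)) = 0" using \<open>\<not> 0 < B\<close> by simp
  then show False
    using saw_nonempty[OF x] finite_saw(1)[OF simple finite_neighbours x] by (metis card_0_eq)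
qed

lemma card_distinct_continuations_le:
  assumes "adjacent E u v"
  shows "card {ys \<in> continuations E L u v. distinct (u # v # ys)} \<le> (d - 1) ^ L"
  using card_mono[OF finite_continuations[OF assms]] card_continuations[OF assms]
  by (metis (no_types, lifting) Collect_subset Collect_mem_eq mem_Collect_eq subsetI)

text \<open>In degree at most \<open>1\<close> no edge would have a continuation of length \<open>1\<close>.\<close>

lemma degree_ge_2: "2 \<le> d"
  using continuation_bound_pos[of 1 "(d - 1) ^ 1"] card_distinct_continuations_le[of _ _ 1] by simp

end

section \<open>Retained walks\<close>

fun walk_edges :: "'a list \<Rightarrow> 'a set set" where
  "walk_edges (x # y # zs) = insert {x, y} (walk_edges (y # zs))"
| "walk_edges [x] = {}"
| "walk_edges [] = {}"

lemma walk_edges_subset: "e \<in> walk_edges xs \<Longrightarrow> e \<subseteq> set xs"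
  by (induction xs rule: walk_edges.induct) auto

lemma finite_walk_edges: "finite (walk_edges xs)"
  by (induction xs rule: walk_edges.induct) auto

lemma walk_edges_subset_E: "successively (adjacent E) xs \<Longrightarrow> walk_edges xs \<subseteq> E"
  by (induction xs rule: walk_edges.induct) (auto simp: adjacent_def)

text \<open>An edge determines its two ends, so a walk without repeated vertices repeats no edge.\<close>

lemma card_walk_edges: "distinct xs \<Longrightarrow> card (walk_edges xs) = length xs - 1"
proof (induction xs rule: walk_edges.induct)
  case (1 x y zs)
  then have "{x, y} \<notin> walk_edges (y # zs)" using walk_edges_subset[of "{x, y}" "y # zs"] by auto
  then show ?case using 1 by (simp add: finite_walk_edges)
qed simp_all

lemma successively_retained:
  "successively (adjacent (retained E \<omega>)) xs \<longleftrightarrow>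
     successively (adjacent E) xs \<and> (\<forall>e\<in>walk_edges xs. \<omega> e)"
  by (induction xs rule: walk_edges.induct) (auto simp: adjacent_def retained_def)

lemma saw_retained: "saw (retained E \<omega>) x n = {xs \<in> saw E x n. \<forall>e\<in>walk_edges xs. \<omega> e}"
  by (auto simp: saw_def successively_retained)

definition retained_event :: "'a set set \<Rightarrow> real \<Rightarrow> 'a set set \<Rightarrow> ('a set \<Rightarrow> bool) set" where
  "retained_event E p F = {\<omega> \<in> space (percolation E p). \<forall>e\<in>F. \<omega> e}"

lemma prob_space_percolation: "prob_space (percolation E p)"
  unfolding percolation_def by (intro prob_space_PiM prob_space_measure_pmf)

lemma sets_retained_event:
  assumes "finite F" "F \<subseteq> E"
  shows "retained_event E p F \<in> sets (percolation E p)"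
proof -
  have "{\<omega> \<in> space (percolation E p). \<omega> e} \<in> sets (percolation E p)" if "e \<in> F" for e
    unfolding percolation_def using assms that by (intro sets_Collect_single') auto
  then show ?thesis
    unfolding retained_event_def using assms(1) by (intro sets.sets_Collect_finite_All) auto
qed

lemma prob_retained_event:
  assumes F: "finite F" "F \<subseteq> E" and p: "0 \<le> p" "p \<le> 1"
  shows "measure (percolation E p) (retained_event E p F) = p ^ card F"
proof -
  interpret product_prob_space "\<lambda>_. measure_pmf (bernoulli_pmf p)" E
    by unfold_locales
  have "emeasure (percolation E p) (retained_event E p F) =
      (\<Prod>e\<in>F. emeasure (measure_pmf (bernoulli_pmf p)) {True})"
    using emeasure_PiM_Collect[OF F(2,1), of "\<lambda>_. {True}"]
    by (simp add: percolation_def retained_event_def)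
  also have "\<dots> = ennreal (p ^ card F)"
    using p by (simp add: emeasure_pmf_single ennreal_power)
  finally show ?thesis using p by (simp add: measure_def)
qed

definition long_walk_event :: "'a set set \<Rightarrow> real \<Rightarrow> 'a \<Rightarrow> nat \<Rightarrow> ('a set \<Rightarrow> bool) set" where
  "long_walk_event E p x n = {\<omega> \<in> space (percolation E p). saw (retained E \<omega>) x n \<noteq> {}}"

lemma long_walk_event_UN:
  "long_walk_event E p x n = (\<Union>xs\<in>saw E x n. retained_event E p (walk_edges xs))"
  by (auto simp: long_walk_event_def retained_event_def saw_retained)

lemma decseq_long_walk_event: "decseq (long_walk_event E p x)"
proof (rule decseq_SucI)
  fix n show "long_walk_event E p x (Suc n) \<subseteq> long_walk_event E p x n"
    using saw_prefix[where n = n and k = 1] by (fastforce simp: long_walk_event_def)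
qed

context regular_connected_graph
begin

lemma sets_long_walk_event:
  assumes "x \<in> V"
  shows "long_walk_event E p x n \<in> sets (percolation E p)"
  unfolding long_walk_event_UN
proof (intro sets.finite_UN sets_retained_event finite_walk_edges)
  show "finite (saw E x n)" by (rule finite_saw(1)[OF simple finite_neighbours assms])
  show "walk_edges xs \<subseteq> E" if "xs \<in> saw E x n" for xs
    using that by (intro walk_edges_subset_E) (simp add: saw_def)
qed

text \<open>The expected number of retained self-avoiding walks bounds the probability that there is
  one.\<close>

lemma prob_long_walk_event_le:
  assumes "x \<in> V" "0 \<le> p" "p \<le> 1"
  shows "measure (percolation E p) (long_walk_event E p x n) \<le> real (card (saw E x n)) * p ^ n"
proof -
  have sub: "finite (walk_edges xs)" "walk_edges xs \<subseteq> E" if "xs \<in> saw E x n" for xs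
    using that finite_walk_edges walk_edges_subset_E by (auto simp: saw_def)
  have "measure (percolation E p) (long_walk_event E p x n) \<le>
      (\<Sum>xs\<in>saw E x n. measure (percolation E p) (retained_event E p (walk_edges xs)))"
    unfolding long_walk_event_UN
    using finite_saw(1)[OF simple finite_neighbours assms(1)] sub
    by (intro measure_UNION_le sets_retained_event) auto
  also have "\<dots> = (\<Sum>xs\<in>saw E x n. p ^ n)"
  proof (rule sum.cong)
    fix xs assume xs: "xs \<in> saw E x n"
    then have "card (walk_edges xs) = n" by (simp add: card_walk_edges saw_def)
    then show "measure (percolation E p) (retained_event E p (walk_edges xs)) = p ^ n"
      using prob_retained_event[OF sub[OF xs] assms(2,3)] by simp
  qed simp
  finally show ?thesis by simp
qed

lemma infinite_component_event:
  "{\<omega> \<in> space (percolation E p). \<exists>C\<in>graph_components V (retained E \<omega>). infinite C} =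
     (\<Union>x\<in>V. \<Inter>n. long_walk_event E p x n)"
proof -
  have *: "infinite (component_of V (retained E \<omega>) x) \<longleftrightarrow> (\<forall>n. saw (retained E \<omega>) x n \<noteq> {})"
    if "x \<in> V" for x \<omega>
  proof (rule infinite_component_iff_saw)
    show "simple_graph V (retained E \<omega>)"
      using simple by (auto simp: simple_graph_def retained_def)
    show "finite (neighbours (retained E \<omega>) u)" if "u \<in> V" for u
      by (rule finite_subset[OF _ finite_neighbours[OF that]])
        (auto simp: neighbours_def adjacent_def retained_def)
  qed (rule that)
  show ?thesis by (auto simp: graph_components_def long_walk_event_def *)
qed

text \<open>By convention a set outside the \<open>\<sigma>\<close>-algebra has measure \<open>0\<close>, so a positive
  percolation probability on trees needs the measurability of this event.\<close>

lemma sets_infinite_component_event: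
  "{\<omega> \<in> space (percolation E p). \<exists>C\<in>graph_components V (retained E \<omega>). infinite C}
     \<in> sets (percolation E p)"
  unfolding infinite_component_event
  using sets_long_walk_event by (intro sets.countable_UN'' countable_V sets.countable_INT) auto

text \<open>Self-avoiding walks that are cut into blocks of \<open>L\<close> edges have at most \<open>B\<close> choices for each
  block, and a block is retained with probability \<open>p ^ L\<close>. The expected number of long retained
  walks therefore decays geometrically.\<close>

lemma percolation_prob_eq_0:
  assumes bound: "\<And>u v. adjacent E u v \<Longrightarrow>
      card {ys \<in> continuations E L u v. distinct (u # v # ys)} \<le> B"
    and p: "0 \<le> p" "p \<le> 1" and small: "real B * p ^ L < 1"
  shows "percolation_prob V E p = 0"
proof -
  interpret prob_space "percolation E p" by (rule prob_space_percolation)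
  have "(\<Inter>n. long_walk_event E p x n) \<in> null_sets (percolation E p)" if x: "x \<in> V" for x
  proof -
    have sets: "(\<Inter>n. long_walk_event E p x n) \<in> sets (percolation E p)"
      using sets_long_walk_event[OF x] by (intro sets.countable_INT) auto
    have "prob (\<Inter>n. long_walk_event E p x n) \<le> real d * p * (real B * p ^ L) ^ k" for k
    proof -
      have "prob (\<Inter>n. long_walk_event E p x n) \<le> prob (long_walk_event E p x (Suc (k * L)))"
        using sets_long_walk_event[OF x] by (intro finite_measure_mono) auto
      also have "\<dots> \<le> real (card (saw E x (Suc (k * L)))) * p ^ Suc (k * L)"
        by (rule prob_long_walk_event_le[OF x p])
      also have "\<dots> \<le> real (d * B ^ k) * p ^ Suc (k * L)"
        using card_saw_le[OF bound x, of k] p by (intro mult_right_mono of_nat_mono) auto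
      also have "\<dots> = real d * p * (real B * p ^ L) ^ k"
        by (simp add: power_mult_distrib power_mult[symmetric] mult.commute mult.left_commute)
      finally show ?thesis .
    qed
    moreover have "(\<lambda>k. real d * p * (real B * p ^ L) ^ k) \<longlonglongrightarrow> real d * p * 0"
      using small p by (intro tendsto_mult_left LIMSEQ_realpow_zero) auto
    ultimately have "prob (\<Inter>n. long_walk_event E p x n) \<le> 0"
      by (intro LIMSEQ_le_const) auto
    then have "prob (\<Inter>n. long_walk_event E p x n) = 0"
      using measure_nonneg order_antisym by blast
    then show ?thesis using sets by (simp add: null_sets_def emeasure_eq_measure)
  qed
  then have "(\<Union>x\<in>V. \<Inter>n. long_walk_event E p x n) \<in> null_sets (percolation E p)"
    by (intro null_sets_UN' countable_V) auto
  then show ?thesis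
    unfolding percolation_prob_def infinite_component_event by (simp add: measure_eq_0_null_sets)
qed

end

section \<open>Cycles near every vertex\<close>

lemma graph_cycle_map:
  assumes "graph_cycle E cs" "inj_on f (set cs)"
    and "\<And>u v. u \<in> set cs \<Longrightarrow> v \<in> set cs \<Longrightarrow> adjacent E u v \<Longrightarrow> adjacent E (f u) (f v)"
  shows "graph_cycle E (map f cs)"
proof -
  have "cs \<noteq> []" using assms(1) by (auto simp: graph_cycle_def)
  then show ?thesis
    using assms by (simp add: graph_cycle_def distinct_map last_map hd_map)
qed

context regular_connected_graph
begin

lemma walk_in_V:
  assumes "successively (adjacent E) xs" "xs \<noteq> []" "hd xs \<in> V"
  shows "set xs \<subseteq> V"
  using assms
proof (induction xs)
  case (Cons x xs)
  then show ?case using adjacent_in_V(2) by (cases "xs = []") (auto simp: successively_Cons)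
qed simp

text \<open>The length of the cycle is a parameter because it must be bounded uniformly over all vertices,
  like the distance. A cycle is split at the vertex where it is entered, so it has \<open>k + 1\<close>
  vertices.\<close>

definition near_cycle :: "nat \<Rightarrow> nat \<Rightarrow> 'a \<Rightarrow> bool" where
  "near_cycle k r v \<longleftrightarrow> (\<exists>g c cs. graph_cycle E (c # cs) \<and> length cs = k \<and>
     successively (adjacent E) (g @ [c]) \<and> hd (g @ [c]) = v \<and> length g \<le> r)"

lemma near_cycle_mono: "near_cycle k r v \<Longrightarrow> r \<le> s \<Longrightarrow> near_cycle k s v"
  unfolding near_cycle_def by (elim exE conjE, intro exI conjI) (assumption | erule (1) le_trans)+

lemma near_cycle_automorphism:
  assumes f: "f \<in> graph_automorphisms V E" and v: "v \<in> V" and near: "near_cycle k r v"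
  shows "near_cycle k r (f v)"
proof -
  obtain g c cs where cyc: "graph_cycle E (c # cs)" and k: "length cs = k"
    and walk: "successively (adjacent E) (g @ [c])" and hd: "hd (g @ [c]) = v" and r: "length g \<le> r"
    using near unfolding near_cycle_def by blast
  have inj: "inj_on f V"
    using f by (simp add: graph_automorphisms_def Bij_def bij_betw_def)
  have adj: "adjacent E (f a) (f b)" if "adjacent E a b" for a b
    using f that adjacent_in_V[OF that] by (simp add: graph_automorphisms_def)
  have gV: "set (g @ [c]) \<subseteq> V" using walk_in_V[OF walk] hd v by simp
  have "successively (adjacent E) (c # cs)"
    using cyc by (simp add: graph_cycle_def successively_conv_nth)
  then have cV: "set (c # cs) \<subseteq> V" using walk_in_V[of "c # cs"] gV by simp
  have "graph_cycle E (map f (c # cs))"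
    using cyc inj_on_subset[OF inj cV] adj by (rule graph_cycle_map)
  moreover have "successively (adjacent E) (map f (g @ [c]))"
    unfolding successively_map using adj by (rule successively_mono[OF walk])
  moreover have "hd (map f (g @ [c])) = f v" using hd hd_map[of "g @ [c]" f] by simp
  ultimately show ?thesis
    unfolding near_cycle_def using k r
    by (intro exI[of _ "map f g"] exI[of _ "f c"] exI[of _ "map f cs"]) auto
qed

text \<open>Automorphisms move cycles to cycles of the same length, so the distance to such a cycle is
  constant on each of the finitely many orbits.\<close>

lemma quasi_transitive_near_cycle:
  assumes qt: "quasi_transitive V E" and cycle: "graph_cycle E (c # cs)"
  shows "\<exists>R. \<forall>v\<in>V. near_cycle (length cs) R v"
proof -
  have "adjacent E (last (c # cs)) c" using cycle by (simp add: graph_cycle_def)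
  then have cV: "c \<in> V" by (rule adjacent_in_V)
  have near: "\<exists>r. near_cycle (length cs) r v" if "v \<in> V" for v
  proof -
    have "(adjacent E)\<^sup>*\<^sup>* v c" using connected that cV by (simp add: connected_graph_def)
    then obtain n xs where xs: "xs \<in> saw E v n" "last xs = c" using reachable_by_saw[of E v c] by blast
    then have "xs \<noteq> []" by (auto simp: saw_def)
    then obtain g where g: "xs = g @ [c]" using xs(2) by (cases xs rule: rev_cases) auto
    show ?thesis
      unfolding near_cycle_def
      by (rule exI[of _ "length g"], intro exI[of _ g] exI[of _ c] exI[of _ cs])
        (use xs(1) cycle g in \<open>simp add: saw_def\<close>)
  qed
  have "\<exists>r. \<forall>v\<in>O'. near_cycle (length cs) r v" if O': "O' \<in> orbits (AUT V E) V (\<lambda>f. f)" for O'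
  proof -
    obtain x where x: "x \<in> V" "O' = orbit (AUT V E) (\<lambda>f. f) x" using O' by (auto simp: orbits_def)
    obtain r where "near_cycle (length cs) r x" using near[OF x(1)] by blast
    then have "near_cycle (length cs) r (f x)" if "f \<in> graph_automorphisms V E" for f
      by (rule near_cycle_automorphism[OF that x(1)])
    moreover have "O' = (\<lambda>f. f x) ` graph_automorphisms V E"
      unfolding x(2) orbit_def AUT_def by auto
    ultimately show ?thesis by blast
  qed
  then have "\<forall>O'\<in>orbits (AUT V E) V (\<lambda>f. f). \<exists>r. \<forall>v\<in>O'. near_cycle (length cs) r v" by (rule ballI)
  from bchoice[OF this] obtain rad where
    "\<forall>O'\<in>orbits (AUT V E) V (\<lambda>f. f). \<forall>v\<in>O'. near_cycle (length cs) (rad O') v" by (rule exE)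
  then have rad: "near_cycle (length cs) (rad O') v"
    if "O' \<in> orbits (AUT V E) V (\<lambda>f. f)" "v \<in> O'" for O' v
    using that by blast
  have fin: "finite (orbits (AUT V E) V (\<lambda>f. f))" using qt by (simp add: quasi_transitive_def)
  have "near_cycle (length cs) (Max (rad ` orbits (AUT V E) V (\<lambda>f. f))) v" if v: "v \<in> V" for v
  proof -
    have O': "orbit (AUT V E) (\<lambda>f. f) v \<in> orbits (AUT V E) V (\<lambda>f. f)"
      using v by (auto simp: orbits_def)
    have "rad (orbit (AUT V E) (\<lambda>f. f) v) \<le> Max (rad ` orbits (AUT V E) V (\<lambda>f. f))"
      using fin O' by (intro Max_ge finite_imageI imageI)
    then show ?thesis by (rule near_cycle_mono[OF rad[OF O' group_action.orbit_refl[OF group_action_AUT v]]])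
  qed
  then show ?thesis by blast
qed

text \<open>As all degrees are at least \<open>2\<close>, a walk can always go on without turning back.\<close>

lemma extend_nonbacktracking:
  assumes "nonbacktracking E (u # v # ys)"
  shows "\<exists>zs. length zs = k \<and> nonbacktracking E (u # v # ys @ zs)"
proof -
  obtain xs a b where xs: "u # v # ys = xs @ [a, b]"
    using append_last_two[of u v ys] by blast
  have "adjacent E a b"
    using assms nonbacktracking_appendD(2)[of E xs "[a, b]"] xs by simp
  then have "card (continuations E k a b) \<noteq> 0" using degree_ge_2 card_continuations by simp
  then have "continuations E k a b \<noteq> {}" by auto
  then obtain zs where zs: "length zs = k" "nonbacktracking E (a # b # zs)"
    by (auto simp: continuations_def)
  have "nonbacktracking E (xs @ a # b # zs)"
    using assms zs(2) xs nonbacktracking_glue by metis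
  moreover have "xs @ a # b # zs = u # v # ys @ zs"
    using xs by (metis append_Cons append_Nil append_assoc)
  ultimately show ?thesis using zs(1) by metis
qed

text \<open>Walking \<open>R\<close> steps away first makes the walk as long as the distance to the nearest of the
  cycles, so that the way to that cycle cannot use up the initial edge. Reaching the cycle takes at
  most \<open>R\<close> further steps and going around it takes \<open>k + 1\<close>.\<close>

lemma nondistinct_continuation:
  assumes near: "\<And>v. v \<in> V \<Longrightarrow> near_cycle k R v" and uv: "adjacent E u v"
  shows "\<exists>ys\<in>continuations E (2 * R + k + 1) u v. \<not> distinct (u # v # ys)"
proof -
  have nb: "nonbacktracking E (u # v # [])" using uv by simp
  obtain xs where xs: "length xs = R" "nonbacktracking E (u # v # xs)"
    using extend_nonbacktracking[OF nb, of R] by auto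
  have "set (u # v # xs) \<subseteq> V"
    using walk_in_V[OF nonbacktracking_imp_walk[OF xs(2)]] adjacent_in_V[OF uv] by simp
  then have "last (v # xs) \<in> V" by auto
  then obtain g c cs where g: "graph_cycle E (c # cs)" "length cs = k"
    "successively (adjacent E) (g @ [c])" "hd (g @ [c]) = last (v # xs)" "length g \<le> R"
    using near unfolding near_cycle_def by blast
  obtain ys where ys: "nonbacktracking E (u # v # ys)" "\<not> distinct (u # v # ys)"
    "length ys \<le> length xs + length g + length cs + 1"
    using reach_cycle_nonbacktracking[OF xs(2) g(3,4) _ graph_cycle_nonbacktracking[OF g(1)]] g(5) xs(1)
    by auto
  obtain zs where "length zs = 2 * R + k + 1 - length ys" "nonbacktracking E (u # v # ys @ zs)"
    using extend_nonbacktracking[OF ys(1)] by blast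
  then have "ys @ zs \<in> continuations E (2 * R + k + 1) u v" "\<not> distinct (u # v # ys @ zs)"
    using ys(2,3) xs(1) g(2,5) by (auto simp: continuations_def)
  then show ?thesis by blast
qed

lemma card_distinct_continuations_less:
  assumes "quasi_transitive V E" "graph_cycle E cs"
  shows "\<exists>L>0. \<forall>u v. adjacent E u v \<longrightarrow>
    card {ys \<in> continuations E L u v. distinct (u # v # ys)} \<le> (d - 1) ^ L - 1"
proof -
  obtain c cs' where cs: "cs = c # cs'" using assms(2) by (cases cs) (auto simp: graph_cycle_def)
  obtain R where R: "\<And>v. v \<in> V \<Longrightarrow> near_cycle (length cs') R v"
    using quasi_transitive_near_cycle[OF assms(1)] assms(2) cs by blast
  define L where "L = 2 * R + length cs' + 1"
  have "card {ys \<in> continuations E L u v. distinct (u # v # ys)} \<le> (d - 1) ^ L - 1"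
    if uv: "adjacent E u v" for u v
  proof -
    obtain ys where "ys \<in> continuations E L u v" "\<not> distinct (u # v # ys)"
      using nondistinct_continuation[OF R uv] by (auto simp: L_def)
    then have "{ys \<in> continuations E L u v. distinct (u # v # ys)} \<subset> continuations E L u v"
      by blast
    then have "card {ys \<in> continuations E L u v. distinct (u # v # ys)} < (d - 1) ^ L"
      using psubset_card_mono[OF finite_continuations[OF uv]] card_continuations[OF uv] by metis
    then show ?thesis by simp
  qed
  moreover have "L > 0" by (simp add: L_def)
  ultimately show ?thesis by blast
qed

section \<open>Bounds for the critical parameter\<close>

lemma le_p_c:
  assumes "0 \<le> p" "p \<le> 1" "percolation_prob V E p = 0"
  shows "p \<le> p_c V E"
  unfolding p_c_def using assms by (intro cSup_upper bdd_aboveI[of _ 1]) auto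

lemma p_c_ge: "1 / (real d - 1) \<le> p_c V E"
proof (rule dense_le)
  have *: "p \<le> p_c V E" if p: "0 \<le> p" "p < 1 / (real d - 1)" for p
  proof (rule le_p_c)
    have d: "real d - 1 \<ge> 1" using degree_ge_2 by simp
    then have "1 / (real d - 1) \<le> 1" by simp
    then show le1: "p \<le> 1" using p by linarith
    have "real ((d - 1) ^ 1) * p ^ 1 < 1"
      using p d degree_ge_2 by (simp add: of_nat_diff field_simps)
    then show "percolation_prob V E p = 0"
      using percolation_prob_eq_0[of 1 "(d - 1) ^ 1"] card_distinct_continuations_le p(1) le1 by blast
  qed (use p in auto)
  fix p :: real assume p: "p < 1 / (real d - 1)"
  show "p \<le> p_c V E"
  proof (cases "0 \<le> p")
    case False
    then show ?thesis using *[of 0] degree_ge_2 by simp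
  qed (use * p in blast)
qed

text \<open>Out of the \<open>(d - 1) ^ L\<close> nonbacktracking continuations of each edge at least one repeats a
  vertex. Losing one continuation in each block makes the growth rate of self-avoiding walks smaller
  than \<open>d - 1\<close>, and the first moment bound gains accordingly. In degree \<open>2\<close> this would leave no
  long self-avoiding walk at all.\<close>

lemma p_c_gt_if_cycle:
  assumes "quasi_transitive V E" "graph_cycle E cs"
  shows "1 / (real d - 1) < p_c V E"
proof -
  obtain L where L: "L > 0" and bound: "\<And>u v. adjacent E u v \<Longrightarrow>
      card {ys \<in> continuations E L u v. distinct (u # v # ys)} \<le> (d - 1) ^ L - 1"
    using card_distinct_continuations_less[OF assms] by blast
  have "0 < (d - 1) ^ L - 1" by (rule continuation_bound_pos[OF bound])
  then have "2 \<le> (d - 1) ^ L" by simp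
  define q where "q = (real d - 1) ^ L"
  have q: "real ((d - 1) ^ L) = q" using degree_ge_2 by (simp add: q_def of_nat_diff)
  have q2: "2 \<le> q" using \<open>2 \<le> (d - 1) ^ L\<close> unfolding q[symmetric] by linarith
  \<comment> \<open>Any \<open>p ^ L\<close> strictly between \<open>1 / q\<close> and \<open>1 / (q - 1)\<close> will do.\<close>
  define p where "p = root L (1 / (q - 1 / 2))"
  have pL: "p ^ L = 1 / (q - 1 / 2)" using L q2 by (simp add: p_def)
  have p: "0 \<le> p" "p \<le> 1" using L q2 by (simp_all add: p_def)
  have B: "real ((d - 1) ^ L - 1) = q - 1"
    using \<open>2 \<le> (d - 1) ^ L\<close> q by (simp add: of_nat_diff)
  have "real ((d - 1) ^ L - 1) * p ^ L < 1"
    unfolding B pL using q2 by (simp add: field_simps)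
  then have "percolation_prob V E p = 0" using percolation_prob_eq_0[OF bound p] by blast
  then have "p \<le> p_c V E" by (rule le_p_c[OF p])
  moreover have "(1 / (real d - 1)) ^ L < p ^ L"
    unfolding pL using q2 by (simp add: power_divide q_def[symmetric] field_simps)
  then have "1 / (real d - 1) < p" using p(1) power_less_imp_less_base by blast
  ultimately show ?thesis by simp
qed

end

section \<open>Survival on trees\<close>

text \<open>This is the second moment inequality \<open>(E N)\<^sup>2 \<le> P (N > 0) E N\<^sup>2\<close> for the number \<open>N\<close> of
  events that occur. It follows by integrating \<open>2 t N - t\<^sup>2 N\<^sup>2 \<le> 1\<close>, that is
  \<open>(1 - t N)\<^sup>2 \<ge> 0\<close>, at the value of \<open>t\<close> that maximises the left hand side when the assumed bound on \<open>E N\<^sup>2\<close> is attained;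
  where \<open>N = 0\<close> the left hand side vanishes.\<close>

lemma (in prob_space) second_moment_bound:
  assumes fin: "finite I" and A: "\<And>i. i \<in> I \<Longrightarrow> A i \<in> events" and "0 < C"
    and pos: "0 < (\<Sum>i\<in>I. prob (A i))"
    and second: "(\<Sum>i\<in>I. \<Sum>j\<in>I. prob (A i \<inter> A j)) \<le> C * (\<Sum>i\<in>I. prob (A i))\<^sup>2"
  shows "1 / C \<le> prob (\<Union>i\<in>I. A i)"
proof -
  define N where "N = (\<lambda>\<omega>. \<Sum>i\<in>I. indicator (A i) \<omega> :: real)"
  define S where "S = (\<Sum>i\<in>I. prob (A i))"
  define t where "t = 1 / (C * S)"
  have sq: "(N \<omega>)\<^sup>2 = (\<Sum>i\<in>I. \<Sum>j\<in>I. indicator (A i \<inter> A j) \<omega>)" for \<omega>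
    by (simp add: N_def power2_eq_square sum_product indicator_inter_arith)
  have ind: "integrable M (indicator B :: 'a \<Rightarrow> real)" "expectation (indicator B) = prob B"
    if "B \<in> events" for B
    using that by (simp_all add: emeasure_eq_measure)
  have U: "(\<Union>i\<in>I. A i) \<in> events" using fin A by blast
  have AA: "A i \<inter> A j \<in> events" if "i \<in> I" "j \<in> I" for i j
    using A that by blast
  have N: "integrable M N" "expectation N = S"
    using A by (simp_all add: N_def S_def ind integral_sum)
  have N2: "integrable M (\<lambda>\<omega>. (N \<omega>)\<^sup>2)"
    "expectation (\<lambda>\<omega>. (N \<omega>)\<^sup>2) = (\<Sum>i\<in>I. \<Sum>j\<in>I. prob (A i \<inter> A j))"
    unfolding sq by (simp_all add: AA ind integral_sum del: integral_indicator)
  have "2 * t * N \<omega> - t\<^sup>2 * (N \<omega>)\<^sup>2 \<le> indicator (\<Union>i\<in>I. A i) \<omega>" for \<omega>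
  proof (cases "\<omega> \<in> (\<Union>i\<in>I. A i)")
    case True
    have "0 \<le> (1 - t * N \<omega>)\<^sup>2" by simp
    then show ?thesis using True by (simp add: power2_eq_square algebra_simps)
  next
    case False
    then have "N \<omega> = 0" by (simp add: N_def)
    then show ?thesis by simp
  qed
  then have "expectation (\<lambda>\<omega>. 2 * t * N \<omega> - t\<^sup>2 * (N \<omega>)\<^sup>2) \<le> expectation (indicator (\<Union>i\<in>I. A i))"
    using N N2 ind(1)[OF U] by (intro integral_mono) auto
  also have "expectation (indicator (\<Union>i\<in>I. A i)) = prob (\<Union>i\<in>I. A i)"
    by (rule ind(2)[OF U])
  also have "expectation (\<lambda>\<omega>. 2 * t * N \<omega> - t\<^sup>2 * (N \<omega>)\<^sup>2) =
      2 * t * S - t\<^sup>2 * (\<Sum>i\<in>I. \<Sum>j\<in>I. prob (A i \<inter> A j))"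
    using N N2 by simp
  finally have "2 * t * S - t\<^sup>2 * (\<Sum>i\<in>I. \<Sum>j\<in>I. prob (A i \<inter> A j)) \<le> prob (\<Union>i\<in>I. A i)" .
  moreover have "t\<^sup>2 * (\<Sum>i\<in>I. \<Sum>j\<in>I. prob (A i \<inter> A j)) \<le> t\<^sup>2 * (C * S\<^sup>2)"
    using second by (intro mult_left_mono) (auto simp: S_def)
  moreover have "2 * t * S - t\<^sup>2 * (C * S\<^sup>2) = 1 / C"
    using pos \<open>0 < C\<close> by (simp add: t_def S_def[symmetric] field_simps power2_eq_square)
  ultimately show ?thesis by linarith
qed

context regular_connected_graph
begin

text \<open>One branch traversed backwards and then the other form a nonbacktracking walk through \<open>v\<close>.
  Without cycles it repeats no vertex, so the branches meet in \<open>v\<close> only.\<close>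

lemma tree_branches_disjoint:
  assumes acyclic: "\<nexists>cs. graph_cycle E cs"
    and nb: "nonbacktracking E (v # w # ys)" "nonbacktracking E (v # w' # zs)" and "w \<noteq> w'"
  shows "walk_edges (v # w # ys) \<inter> walk_edges (v # w' # zs) = {}"
proof -
  have "nonbacktracking E (rev (v # w # ys))" using nb(1) by (simp only: nonbacktracking_rev)
  then have 1: "nonbacktracking E ((rev ys) @ [w, v])" by simp
  have "nonbacktracking E ((rev ys) @ [w, v, w'])"
    unfolding nonbacktracking_snoc2 using 1 nb(2) \<open>w \<noteq> w'\<close> by (cases zs) auto
  then have "nonbacktracking E ((rev ys @ [w]) @ v # w' # zs)"
    using nonbacktracking_glue[of E "rev ys @ [w]" v w' zs] nb(2) by simp
  then have dist: "distinct ((rev ys @ [w]) @ v # w' # zs)"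
    using nonbacktracking_distinct_or_cycle[OF simple] acyclic by blast
  have "False" if e: "e \<in> walk_edges (v # w # ys)" "e \<in> walk_edges (v # w' # zs)" for e
  proof -
    have "e \<subseteq> {v}" using walk_edges_subset[OF e(1)] walk_edges_subset[OF e(2)] dist by auto
    then have "card e \<le> 1" using card_mono[of "{v}" e] by simp
    moreover have "e \<in> E"
      using walk_edges_subset_E[OF nonbacktracking_imp_walk[OF nb(1)]] e(1) by blast
    ultimately show False using simple by (auto simp: simple_graph_def)
  qed
  then show ?thesis by blast
qed

text \<open>The left hand side is the second moment of the number of retained walks that start with the
  edge \<open>{u, v}\<close>. Let \<open>m = d - 1\<close> and let \<open>M\<close> be the first moment for walks with one step less.
  Two walks that separate after \<open>{u, v}\<close> share no further edge and contribute \<open>p M\<^sup>2\<close>; two walks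
  that take the same next step contribute \<open>p\<close> times the second moment from there. If the latter is
  at most \<open>C M\<^sup>2\<close>, the total is at most \<open>m p (C + m - 1) M\<^sup>2\<close>, while the new first moment is
  \<open>m p M\<close>. Hence the ratio stays below the fixed point \<open>C = (m - 1) / (m p - 1)\<close>, which is finite
  precisely above the critical value.\<close>

lemma tree_pair_sum_le:
  assumes acyclic: "\<nexists>cs. graph_cycle E cs"
    and p: "0 \<le> p" "p \<le> 1" "1 < (real d - 1) * p"
    and uv: "adjacent E u v"
  shows "(\<Sum>ys\<in>continuations E n u v. \<Sum>zs\<in>continuations E n u v.
      p ^ card (walk_edges (u # v # ys) \<union> walk_edges (u # v # zs)))
    \<le> (real d - 2) / ((real d - 1) * p - 1) * ((real d - 1) ^ n * p ^ Suc n)\<^sup>2"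
  using uv
proof (induction n arbitrary: u v)
  case 0
  have "1 \<le> (real d - 2) / ((real d - 1) * p - 1) * p"
    using p by (simp add: field_simps)
  then have "1 * p \<le> (real d - 2) / ((real d - 1) * p - 1) * p * p"
    using p(1) by (rule mult_right_mono)
  then show ?case using 0 by (simp add: continuations_0 power2_eq_square mult.assoc)
next
  case (Suc n)
  define m where "m = real d - 1"
  define C where "C = (real d - 2) / ((real d - 1) * p - 1)"
  define Mn where "Mn = m ^ n * p ^ Suc n"
  define W where "W = neighbours E v - {u}"
  \<comment> \<open>The pairs of walks are sorted by their next steps \<open>w\<close> and \<open>w'\<close>.\<close>
  define S where "S w w' = (\<Sum>ys\<in>continuations E n v w. \<Sum>zs\<in>continuations E n v w'.
      p ^ card (walk_edges (u # v # w # ys) \<union> walk_edges (u # v # w' # zs)))" for w w'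
  have W: "adjacent E v w" "w \<noteq> u" if "w \<in> W" for w using that by (auto simp: W_def neighbours_def)
  have finW: "finite W" using adjacent_in_V[OF Suc.prems] finite_neighbours by (simp add: W_def)
  have cardW: "real (card W) = m"
    using card_neighbours_Diff[OF Suc.prems] degree_ge_2 by (simp add: W_def m_def of_nat_diff)
  have dist: "distinct (u # v # w # ys)" "nonbacktracking E (v # w # ys)"
    if "w \<in> W" "ys \<in> continuations E n v w" for w ys
  proof -
    show nb: "nonbacktracking E (v # w # ys)" using that by (simp add: continuations_def)
    then have "nonbacktracking E (u # v # w # ys)"
      using Suc.prems W[OF that(1)] by simp
    then show "distinct (u # v # w # ys)"
      using nonbacktracking_distinct_or_cycle[OF simple] acyclic by blast
  qed
  have step: "card (walk_edges (u # v # w # ys) \<union> walk_edges (u # v # w' # zs)) =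
      Suc (card (walk_edges (v # w # ys) \<union> walk_edges (v # w' # zs)))"
    if "w \<in> W" "w' \<in> W" "ys \<in> continuations E n v w" "zs \<in> continuations E n v w'" for w w' ys zs
  proof -
    have "{u, v} \<notin> walk_edges (v # w # ys)" "{u, v} \<notin> walk_edges (v # w' # zs)"
      using walk_edges_subset[of "{u, v}" "v # w # ys"] walk_edges_subset[of "{u, v}" "v # w' # zs"]
        dist that by fastforce+
    moreover have "walk_edges (u # v # w # ys) \<union> walk_edges (u # v # w' # zs) =
        insert {u, v} (walk_edges (v # w # ys) \<union> walk_edges (v # w' # zs))"
      by auto
    ultimately show ?thesis
      using finite_walk_edges[of "v # w # ys"] finite_walk_edges[of "v # w' # zs"]
      by (simp only: card_insert_disjoint finite_UnI Un_iff) simp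
  qed
  have diag: "S w w \<le> p * (C * Mn\<^sup>2)" if w: "w \<in> W" for w
  proof -
    have "S w w = p * (\<Sum>ys\<in>continuations E n v w. \<Sum>zs\<in>continuations E n v w.
        p ^ card (walk_edges (v # w # ys) \<union> walk_edges (v # w # zs)))"
      unfolding S_def sum_distrib_left using step[OF w w]
      by (intro sum.cong refl) (simp only: power_Suc)
    also have "\<dots> \<le> p * (C * Mn\<^sup>2)"
      using Suc.IH[OF W(1)[OF w]] p(1) unfolding C_def Mn_def m_def by (rule mult_left_mono)
    finally show ?thesis .
  qed
  have off: "S w w' = p * Mn\<^sup>2" if w: "w \<in> W" "w' \<in> W" and ne: "w \<noteq> w'" for w w'
  proof -
    have "p ^ card (walk_edges (u # v # w # ys) \<union> walk_edges (u # v # w' # zs)) =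
        p * (p ^ Suc n * p ^ Suc n)"
      if yz: "ys \<in> continuations E n v w" "zs \<in> continuations E n v w'" for ys zs
    proof -
      have len: "length ys = n" "length zs = n" using yz by (simp_all add: continuations_def)
      have "card (walk_edges (v # w # ys) \<union> walk_edges (v # w' # zs)) =
          card (walk_edges (v # w # ys)) + card (walk_edges (v # w' # zs))"
        using tree_branches_disjoint[OF acyclic _ _ ne] dist w yz
        by (intro card_Un_disjoint finite_walk_edges) blast
      also have "\<dots> = Suc n + Suc n"
        using dist(1)[OF w(1) yz(1)] dist(1)[OF w(2) yz(2)] len
          card_walk_edges[of "v # w # ys"] card_walk_edges[of "v # w' # zs"] by simp
      finally show ?thesis using step[OF w yz] by (simp only: power_Suc power_add)
    qed
    then have "S w w' = real (card (continuations E n v w)) * real (card (continuations E n v w')) *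
        (p * (p ^ Suc n * p ^ Suc n))"
      unfolding S_def by simp
    also have "\<dots> = p * Mn\<^sup>2"
      using W w degree_ge_2
      by (simp add: card_continuations Mn_def m_def of_nat_diff power2_eq_square algebra_simps)
    finally show ?thesis .
  qed
  have "(\<Sum>ys\<in>continuations E (Suc n) u v. \<Sum>zs\<in>continuations E (Suc n) u v.
      p ^ card (walk_edges (u # v # ys) \<union> walk_edges (u # v # zs))) = (\<Sum>w\<in>W. \<Sum>w'\<in>W. S w w')"
    unfolding S_def sum_continuations_Suc[OF Suc.prems] W_def[symmetric]
    by (intro sum.cong refl) (rule sum.swap)
  also have "\<dots> \<le> (\<Sum>w\<in>W. p * (C * Mn\<^sup>2) + (m - 1) * (p * Mn\<^sup>2))"
  proof (rule sum_mono)
    fix w assume w: "w \<in> W"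
    have "(\<Sum>w'\<in>W. S w w') = S w w + (\<Sum>w'\<in>W - {w}. S w w')"
      using finW w by (rule sum.remove)
    also have "(\<Sum>w'\<in>W - {w}. S w w') = (\<Sum>w'\<in>W - {w}. p * Mn\<^sup>2)"
      using off w by (intro sum.cong) auto
    also have "\<dots> = (m - 1) * (p * Mn\<^sup>2)"
    proof -
      have "1 \<le> card W" using finW w card_gt_0_iff[of W] by (auto simp: Suc_le_eq)
      then show ?thesis using finW w cardW by (simp add: of_nat_diff)
    qed
    finally show "(\<Sum>w'\<in>W. S w w') \<le> p * (C * Mn\<^sup>2) + (m - 1) * (p * Mn\<^sup>2)"
      using diag[OF w] by simp
  qed
  also have "\<dots> = m * p * (C + (m - 1)) * Mn\<^sup>2"
    using cardW by (simp add: algebra_simps)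
  also have "C + (m - 1) = C * (m * p)"
    using p(3) by (simp add: C_def m_def field_simps)
  also have "m * p * (C * (m * p)) * Mn\<^sup>2 = C * (m ^ Suc n * p ^ Suc (Suc n))\<^sup>2"
    by (simp add: Mn_def power2_eq_square algebra_simps)
  finally show ?case by (simp only: C_def m_def)
qed

lemma tree_long_walk_prob_ge:
  assumes acyclic: "\<nexists>cs. graph_cycle E cs"
    and p: "0 \<le> p" "p \<le> 1" "1 < (real d - 1) * p"
    and xy: "adjacent E x y"
  shows "((real d - 1) * p - 1) / (real d - 2)
    \<le> measure (percolation E p) (long_walk_event E p x (Suc n))"
proof -
  interpret prob_space "percolation E p" by (rule prob_space_percolation)
  define I where "I = continuations E n x y"
  define A where "A ys = retained_event E p (walk_edges (x # y # ys))" for ys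
  define C where "C = (real d - 2) / ((real d - 1) * p - 1)"
  have pos: "0 < p" using p by (cases "p = 0") auto
  have "(real d - 1) * p \<le> (real d - 1) * 1" using p degree_ge_2 by (intro mult_left_mono) auto
  then have d2: "2 < real d" using p(3) by simp
  have nb: "nonbacktracking E (x # y # ys)" "length ys = n" if "ys \<in> I" for ys
    using that by (simp_all add: I_def continuations_def)
  have dist: "distinct (x # y # ys)" if "ys \<in> I" for ys
    using nonbacktracking_distinct_or_cycle[OF simple nb(1)[OF that]] acyclic by blast
  have sub: "walk_edges (x # y # ys) \<subseteq> E" if "ys \<in> I" for ys
    using nb(1)[OF that] by (intro walk_edges_subset_E nonbacktracking_imp_walk)
  have prob: "prob (A ys) = p ^ Suc n" if "ys \<in> I" for ys
    using prob_retained_event[OF finite_walk_edges sub[OF that] p(1,2)]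
      card_walk_edges[OF dist[OF that]] nb(2)[OF that] by (simp add: A_def)
  have "A ys \<inter> A zs = retained_event E p (walk_edges (x # y # ys) \<union> walk_edges (x # y # zs))"
    for ys zs by (auto simp: A_def retained_event_def)
  then have prob2: "prob (A ys \<inter> A zs) = p ^ card (walk_edges (x # y # ys) \<union> walk_edges (x # y # zs))"
    if "ys \<in> I" "zs \<in> I" for ys zs
    using that by (simp only:) (intro prob_retained_event finite_UnI finite_walk_edges Un_least sub p)
  have sum: "(\<Sum>ys\<in>I. prob (A ys)) = (real d - 1) ^ n * p ^ Suc n"
    using prob card_continuations[OF xy] degree_ge_2 by (simp add: I_def of_nat_diff)
  have "1 / C \<le> prob (\<Union>ys\<in>I. A ys)"
  proof (rule second_moment_bound)
    show "finite I" using finite_continuations[OF xy] by (simp add: I_def)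
    show "A ys \<in> events" if "ys \<in> I" for ys
      unfolding A_def using sets_retained_event[OF finite_walk_edges sub[OF that]] .
    show "0 < C" using p d2 by (simp add: C_def)
    show "0 < (\<Sum>ys\<in>I. prob (A ys))" unfolding sum using pos d2 by simp
    have "(\<Sum>ys\<in>I. \<Sum>zs\<in>I. prob (A ys \<inter> A zs)) =
        (\<Sum>ys\<in>I. \<Sum>zs\<in>I. p ^ card (walk_edges (x # y # ys) \<union> walk_edges (x # y # zs)))"
      using prob2 by (intro sum.cong refl) auto
    also have "\<dots> \<le> C * (\<Sum>ys\<in>I. prob (A ys))\<^sup>2"
      unfolding sum unfolding C_def I_def by (rule tree_pair_sum_le[OF acyclic p xy])
    finally show "(\<Sum>ys\<in>I. \<Sum>zs\<in>I. prob (A ys \<inter> A zs)) \<le> C * (\<Sum>ys\<in>I. prob (A ys))\<^sup>2" .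
  qed
  also have "prob (\<Union>ys\<in>I. A ys) \<le> prob (long_walk_event E p x (Suc n))"
  proof (rule finite_measure_mono)
    show "long_walk_event E p x (Suc n) \<in> events"
      by (rule sets_long_walk_event[OF adjacent_in_V(1)[OF xy]])
    have "x # y # ys \<in> saw E x (Suc n)" if "ys \<in> I" for ys
      using dist[OF that] nb(2)[OF that] nonbacktracking_imp_walk[OF nb(1)[OF that]]
      by (simp add: saw_def)
    then show "(\<Union>ys\<in>I. A ys) \<subseteq> long_walk_event E p x (Suc n)"
      unfolding long_walk_event_UN A_def by blast
  qed
  finally show ?thesis by (simp add: C_def)
qed

text \<open>The bound for walks of a given length does not depend on the length, so it survives in the
  limit of the decreasing events.\<close>

lemma tree_percolation_prob_pos:
  assumes acyclic: "\<nexists>cs. graph_cycle E cs"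
    and p: "0 \<le> p" "p \<le> 1" "1 < (real d - 1) * p"
  shows "0 < percolation_prob V E p"
proof -
  interpret prob_space "percolation E p" by (rule prob_space_percolation)
  obtain x where x: "x \<in> V" using connected by (auto simp: connected_graph_def)
  obtain y where xy: "adjacent E x y"
    using saw_nonempty[OF x, of 1] by (auto simp: saw_def length_Suc_conv)
  define c where "c = ((real d - 1) * p - 1) / (real d - 2)"
  have "(real d - 1) * p \<le> (real d - 1) * 1" using p degree_ge_2 by (intro mult_left_mono) auto
  then have "0 < c" using p(3) by (simp add: c_def)
  have "(\<lambda>n. prob (long_walk_event E p x n)) \<longlonglongrightarrow> prob (\<Inter>n. long_walk_event E p x n)"
    using sets_long_walk_event[OF x] decseq_long_walk_event by (intro finite_Lim_measure_decseq) auto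
  then have "(\<lambda>n. prob (long_walk_event E p x (Suc n))) \<longlonglongrightarrow> prob (\<Inter>n. long_walk_event E p x n)"
    by (rule LIMSEQ_Suc)
  then have "c \<le> prob (\<Inter>n. long_walk_event E p x n)"
    unfolding c_def using tree_long_walk_prob_ge[OF acyclic p xy] by (intro LIMSEQ_le_const) auto
  also have "\<dots> \<le> percolation_prob V E p"
    unfolding percolation_prob_def
    using sets_infinite_component_event x
    by (intro finite_measure_mono) (auto simp: infinite_component_event)
  finally show ?thesis using \<open>0 < c\<close> by simp
qed

lemma p_c_le_if_acyclic:
  assumes "\<nexists>cs. graph_cycle E cs"
  shows "p_c V E \<le> 1 / (real d - 1)"
  unfolding p_c_def
proof (rule cSup_least)
  show "{p \<in> {0..1}. percolation_prob V E p = 0} \<noteq> {}"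
  proof -
    have "percolation_prob V E 0 = 0"
      by (rule percolation_prob_eq_0[of 1 "(d - 1) ^ 1"])
        (rule card_distinct_continuations_le, simp_all)
    then have "0 \<in> {p \<in> {0..1}. percolation_prob V E p = 0}" by simp
    then show ?thesis by blast
  qed
next
  fix p assume p: "p \<in> {p \<in> {0..1}. percolation_prob V E p = 0}"
  then have "\<not> 1 < (real d - 1) * p" using tree_percolation_prob_pos[OF assms, of p] by auto
  then show "p \<le> 1 / (real d - 1)" using degree_ge_2 by (simp add: field_simps)
qed

end

theorem theorem2:
  fixes V :: "'a set" and E :: "'a set set" and d :: nat
  assumes "simple_graph V E"
    and "infinite V"
    and "connected_graph V E"
    and "locally_finite V E"
    and "quasi_transitive V E"
    and "regular_graph d V E"
  shows "p_c V E \<ge> 1 / (real d - 1) \<and>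
         (p_c V E = 1 / (real d - 1) \<longleftrightarrow> tree_graph V E)"
proof -
  interpret regular_connected_graph V E d
    using assms by unfold_locales
  show ?thesis
  proof (intro conjI iffI)
    show "1 / (real d - 1) \<le> p_c V E" by (rule p_c_ge)
    show "tree_graph V E" if "p_c V E = 1 / (real d - 1)"
      using p_c_gt_if_cycle[OF assms(5)] that connected by (fastforce simp: tree_graph_def)
    show "p_c V E = 1 / (real d - 1)" if "tree_graph V E"
      using p_c_ge p_c_le_if_acyclic that by (intro antisym) (auto simp: tree_graph_def)
  qed
qed

end
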